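(* Let $V$ be a Hilbert space over $\mathbb{K}=\mathbb{R}$ or $\mathbb{C}$, let $A_0$ be a densely defined skew-symmetric operator on $V$ with closure $\overline{A_0}$, and let $A:=-A_0^*$. For $w\in D(A)$ let $w=w_0+w_++w_-$ be the decomposition of $w$ according to $D(A)=D(\overline{A_0})\oplus\ker(\mathrm{Id}-A)\oplus\ker(\mathrm{Id}+A)$, where $w_0\in D(\overline{A_0})$, $w_+,w_-\in D(A)$, $Aw_+=w_+$, $-Aw_-=w_-$. Put $H_-:=\ker(\mathrm{Id}+A)$ and $H_+:=\ker(\mathrm{Id}-A)$, both equipped with the graph inner product $\langle u,v\rangle_V+\langle Au,Av\rangle_V=2\langle u,v\rangle_V$. Then $G_+w:=w_+$ and $G_-w:=w_-$ define a boundary quadruple $(H_-,H_+,G_-,G_+)$ for $A_0$.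
   Context: Inner products are linear in the first argument (and conjugate-linear in the second if $\mathbb{K}=\mathbb{C}$). An operator on $V$ is a linear map defined on a linear subspace (its domain) of $V$ with values in $V$. $A_0$ is skew-symmetric if $\langle A_0u,v\rangle_V+\langle u,A_0v\rangle_V=0$ for all $u,v\in D(A_0)$; a densely defined skew-symmetric operator is closable and $\overline{A_0}$ is again skew-symmetric. With $A:=-A_0^*$, $D(A)=D(A_0^* )$, one has $A_0\subset A$. The (algebraic) direct sum decomposition $D(A)=D(\overline{A_0})\oplus\ker(\mathrm{Id}-A)\oplus\ker(\mathrm{Id}+A)$ always holds, so $w_0,w_+,w_-$ are uniquely determined by $w$. A boundary quadruple $(H_-,H_+,G_-,G_+)$ for $A_0$ consists of pre-Hilbert spaces $H_-,H_+$ over $\mathbb{K}$ and surjective linear maps $G_-:D(A)\to H_-$, $G_+:D(A)\to H_+$ such that $\langle Au,v\rangle_V+\langle u,Av\rangle_V=\langle G_+u,G_+v\rangle_{H_+}-\langle G_-u,G_-v\rangle_{H_-}$ for all $u,v\in D(A)$, and $\ker G_-+\ker G_+=D(A)$. *)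

theory Defs
  imports "HOL-Analysis.Analysis"
begin

text \<open>
  The scalar field. The axioms admit only the reals and the complex numbers: every \<open>x\<close> is a
  root of \<open>t\<^sup>2 - (x + conjg x) * t + x * conjg x\<close>, whose coefficients are
  fixed by \<open>conjg\<close> and hence real, so the field is algebraic over the reals; \<open>conjg\<close> is then
  determined by \<open>conjg_norm\<close>.
\<close>

class real_or_complex = real_normed_field +
  fixes conjg :: "'a \<Rightarrow> 'a"
  assumes conjg_add: "conjg (x + y) = conjg x + conjg y"
    and conjg_mult: "conjg (x * y) = conjg x * conjg y"
    and conjg_conjg: "conjg (conjg x) = x"
    and conjg_norm: "x * conjg x = scaleR ((norm x)\<^sup>2) 1"
    and conjg_fixed: "conjg x = x \<Longrightarrow> \<exists>r. x = scaleR r 1"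

instantiation real :: real_or_complex
begin
definition conjg_real :: "real \<Rightarrow> real" where "conjg_real x = x"
instance
  by standard (auto simp: conjg_real_def power2_eq_square)
end

instantiation complex :: real_or_complex
begin
definition conjg_complex :: "complex \<Rightarrow> complex" where "conjg_complex = cnj"
instance
proof
  fix x :: complex
  show "x * conjg x = scaleR ((norm x)\<^sup>2) 1"
    by (metis complex_norm_square conjg_complex_def of_real_def)
  assume "conjg x = x"
  then show "\<exists>r. x = scaleR r 1"
    by (metis Reals_cases Reals_cnj_iff conjg_complex_def of_real_def)
qed (simp_all add: conjg_complex_def)
end

text \<open>
  A space is a subspace \<open>carr\<close> of an ambient vector space (the type \<open>'v\<close> with \<open>scl\<close>), together
  with a form whose values are relevant on \<open>carr\<close> only.
\<close>

record ('k, 'v) inner_space =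
  carr :: "'v set"
  scl :: "'k \<Rightarrow> 'v \<Rightarrow> 'v"
  ip :: "'v \<Rightarrow> 'v \<Rightarrow> 'k"

definition pre_hilbert_space :: "('k::real_or_complex, 'v::ab_group_add) inner_space \<Rightarrow> bool" where
  "pre_hilbert_space V \<longleftrightarrow>
     vector_space (scl V) \<and> module.subspace (scl V) (carr V) \<and>
     (\<forall>x\<in>carr V. \<forall>y\<in>carr V. \<forall>z\<in>carr V. ip V (x + y) z = ip V x z + ip V y z) \<and>
     (\<forall>a. \<forall>x\<in>carr V. \<forall>z\<in>carr V. ip V (scl V a x) z = a * ip V x z) \<and>
     (\<forall>x\<in>carr V. \<forall>y\<in>carr V. ip V y x = conjg (ip V x y)) \<and>
     (\<forall>x\<in>carr V. x \<noteq> 0 \<longrightarrow> (\<exists>r>0. ip V x x = of_real r))"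

text \<open>
  The locale \<open>Metric_space\<close> demands symmetry outside the carrier as well, hence the case
  distinction.
\<close>

definition ip_dist :: "('k::real_or_complex, 'v::ab_group_add) inner_space \<Rightarrow> 'v \<Rightarrow> 'v \<Rightarrow> real" where
  "ip_dist V x y =
     (if x \<in> carr V \<and> y \<in> carr V then sqrt (norm (ip V (x - y) (x - y))) else 0)"

definition ip_topology :: "('k::real_or_complex, 'v::ab_group_add) inner_space \<Rightarrow> 'v topology" where
  "ip_topology V = Metric_space.mtopology (carr V) (ip_dist V)"

definition hilbert_space :: "('k::real_or_complex, 'v::ab_group_add) inner_space \<Rightarrow> bool" where
  "hilbert_space V \<longleftrightarrow> pre_hilbert_space V \<and> Metric_space.mcomplete (carr V) (ip_dist V)"

text \<open>Values of \<open>op_app\<close> outside of \<open>op_dom\<close> are irrelevant.\<close>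

record 'v oper =
  op_dom :: "'v set"
  op_app :: "'v \<Rightarrow> 'v"

definition linear_map_on ::
  "'v set \<Rightarrow> ('k \<Rightarrow> 'v::ab_group_add \<Rightarrow> 'v) \<Rightarrow> ('k \<Rightarrow> 'w::ab_group_add \<Rightarrow> 'w) \<Rightarrow> ('v \<Rightarrow> 'w) \<Rightarrow> bool" where
  "linear_map_on D s t f \<longleftrightarrow>
     (\<forall>x\<in>D. \<forall>y\<in>D. f (x + y) = f x + f y) \<and> (\<forall>a. \<forall>x\<in>D. f (s a x) = t a (f x))"

definition operator_on :: "('k::real_or_complex, 'v::ab_group_add) inner_space \<Rightarrow> 'v oper \<Rightarrow> bool" where
  "operator_on V T \<longleftrightarrow>
     op_dom T \<subseteq> carr V \<and> module.subspace (scl V) (op_dom T) \<and>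
     op_app T ` op_dom T \<subseteq> carr V \<and> linear_map_on (op_dom T) (scl V) (scl V) (op_app T)"

definition densely_defined :: "('k::real_or_complex, 'v::ab_group_add) inner_space \<Rightarrow> 'v oper \<Rightarrow> bool" where
  "densely_defined V T \<longleftrightarrow> ip_topology V closure_of op_dom T = carr V"

definition skew_symmetric :: "('k::real_or_complex, 'v::ab_group_add) inner_space \<Rightarrow> 'v oper \<Rightarrow> bool" where
  "skew_symmetric V T \<longleftrightarrow>
     (\<forall>u\<in>op_dom T. \<forall>v\<in>op_dom T. ip V (op_app T u) v + ip V u (op_app T v) = 0)"

definition op_graph :: "'v oper \<Rightarrow> ('v \<times> 'v) set" where
  "op_graph T = (\<lambda>u. (u, op_app T u)) ` op_dom T"

text \<open>Only meaningful for single-valued relations.\<close>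

definition op_of_graph :: "('v \<times> 'v) set \<Rightarrow> 'v oper" where
  "op_of_graph R = \<lparr>op_dom = Domain R, op_app = (\<lambda>u. THE w. (u, w) \<in> R)\<rparr>"

definition op_closure :: "('k::real_or_complex, 'v::ab_group_add) inner_space \<Rightarrow> 'v oper \<Rightarrow> 'v oper" where
  "op_closure V T =
     op_of_graph (prod_topology (ip_topology V) (ip_topology V) closure_of op_graph T)"

definition op_adjoint :: "('k::real_or_complex, 'v::ab_group_add) inner_space \<Rightarrow> 'v oper \<Rightarrow> 'v oper" where
  "op_adjoint V T =
     op_of_graph {(v, w). v \<in> carr V \<and> w \<in> carr V \<and>
       (\<forall>u\<in>op_dom T. ip V (op_app T u) v = ip V u w)}"

definition op_uminus :: "'v::ab_group_add oper \<Rightarrow> 'v oper" where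
  "op_uminus T = \<lparr>op_dom = op_dom T, op_app = (\<lambda>u. - op_app T u)\<rparr>"

definition max_op :: "('k::real_or_complex, 'v::ab_group_add) inner_space \<Rightarrow> 'v oper \<Rightarrow> 'v oper" where
  "max_op V A0 = op_uminus (op_adjoint V A0)"

definition boundary_quadruple ::
  "('k::real_or_complex, 'v::ab_group_add) inner_space \<Rightarrow> 'v oper \<Rightarrow>
   ('k, 'm::ab_group_add) inner_space \<Rightarrow> ('k, 'p::ab_group_add) inner_space \<Rightarrow>
   ('v \<Rightarrow> 'm) \<Rightarrow> ('v \<Rightarrow> 'p) \<Rightarrow> bool" where
  "boundary_quadruple V A0 Hm Hp Gm Gp \<longleftrightarrow>
     (let A = max_op V A0; D = op_dom A in
        pre_hilbert_space Hm \<and> pre_hilbert_space Hp \<and>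
        linear_map_on D (scl V) (scl Hm) Gm \<and> Gm ` D = carr Hm \<and>
        linear_map_on D (scl V) (scl Hp) Gp \<and> Gp ` D = carr Hp \<and>
        (\<forall>u\<in>D. \<forall>v\<in>D. ip V (op_app A u) v + ip V u (op_app A v)
                       = ip Hp (Gp u) (Gp v) - ip Hm (Gm u) (Gm v)) \<and>
        {u + v | u v. u \<in> D \<and> Gm u = 0 \<and> v \<in> D \<and> Gp v = 0} = D)"

definition ker_id_minus :: "'v::ab_group_add oper \<Rightarrow> 'v set" where
  "ker_id_minus T = {u \<in> op_dom T. u - op_app T u = 0}"

definition ker_id_plus :: "'v::ab_group_add oper \<Rightarrow> 'v set" where
  "ker_id_plus T = {u \<in> op_dom T. u + op_app T u = 0}"

definition graph_ip :: "('k::real_or_complex, 'v::ab_group_add) inner_space \<Rightarrow> 'v oper \<Rightarrow> 'v \<Rightarrow> 'v \<Rightarrow> 'k" where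
  "graph_ip V T u v = ip V u v + ip V (op_app T u) (op_app T v)"

definition H_minus :: "('k::real_or_complex, 'v::ab_group_add) inner_space \<Rightarrow> 'v oper \<Rightarrow> ('k, 'v) inner_space" where
  "H_minus V A0 = \<lparr>carr = ker_id_plus (max_op V A0), scl = scl V, ip = graph_ip V (max_op V A0)\<rparr>"

definition H_plus :: "('k::real_or_complex, 'v::ab_group_add) inner_space \<Rightarrow> 'v oper \<Rightarrow> ('k, 'v) inner_space" where
  "H_plus V A0 = \<lparr>carr = ker_id_minus (max_op V A0), scl = scl V, ip = graph_ip V (max_op V A0)\<rparr>"

definition is_decomposition ::
  "('k::real_or_complex, 'v::ab_group_add) inner_space \<Rightarrow> 'v oper \<Rightarrow> 'v \<Rightarrow> 'v \<Rightarrow> 'v \<Rightarrow> 'v \<Rightarrow> bool" where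
  "is_decomposition V A0 w w0 wp wm \<longleftrightarrow>
     w = w0 + wp + wm \<and> w0 \<in> op_dom (op_closure V A0) \<and>
     wp \<in> ker_id_minus (max_op V A0) \<and> wm \<in> ker_id_plus (max_op V A0)"

text \<open>
  The descriptions below are well defined for \<open>w\<close> in the domain of \<open>max_op V A0\<close>, because that domain is
  the direct sum of the three subspaces when \<open>A0\<close> is densely defined and skew-symmetric.
\<close>

definition G_plus :: "('k::real_or_complex, 'v::ab_group_add) inner_space \<Rightarrow> 'v oper \<Rightarrow> 'v \<Rightarrow> 'v" where
  "G_plus V A0 w = (THE wp. \<exists>w0 wm. is_decomposition V A0 w w0 wp wm)"

definition G_minus :: "('k::real_or_complex, 'v::ab_group_add) inner_space \<Rightarrow> 'v oper \<Rightarrow> 'v \<Rightarrow> 'v" where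
  "G_minus V A0 w = (THE wm. \<exists>w0 wp. is_decomposition V A0 w w0 wp wm)"

end

theory Submission
  imports Defs
begin

text \<open>
  Projecting \<open>(w, A w)\<close> orthogonally onto the closure of the graph of \<open>A0\<close> in \<open>V \<times> V\<close> gives the
  decomposition of \<open>w\<close>. The boundary form \<open>b(u, v) = \<langle>A u, v\<rangle> + \<langle>u, A v\<rangle>\<close> vanishes as soon as one argument
  lies in the domain of the closure of \<open>A0\<close>, so the components of \<open>w\<close> are characterised by
  \<open>b(w, q) = 2 \<langle>w\<^sub>+, q\<rangle>\<close> for \<open>q\<close> in \<open>ker(Id - A)\<close> and \<open>b(w, n) = - 2 \<langle>w\<^sub>-, n\<rangle>\<close> for \<open>n\<close> in \<open>ker(Id + A)\<close>.
  Uniqueness, linearity and the boundary identity all follow from these two formulas.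
\<close>

section \<open>Conjugation on the scalar field\<close>

lemma conjg_zero [simp]: "conjg 0 = (0::'k::real_or_complex)"
  by (metis add_cancel_right_left conjg_add)

lemma conjg_minus: "conjg (- x) = - conjg (x::'k::real_or_complex)"
  by (metis add.right_inverse conjg_add conjg_zero minus_unique)

lemma mult_conjg: "x * conjg x = of_real ((norm x)\<^sup>2)" for x :: "'k::real_or_complex"
  by (simp add: conjg_norm of_real_def)

text \<open>The product \<open>x * conjg x\<close> is invariant under exchanging x with
  \<open>conjg x\<close>, and it determines the norm.\<close>

lemma norm_conjg [simp]: "norm (conjg x) = norm (x::'k::real_or_complex)"
proof -
  have "(of_real ((norm x)\<^sup>2) :: 'k) = of_real ((norm (conjg x))\<^sup>2)"
    by (metis mult_conjg conjg_conjg mult.commute)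
  then show ?thesis
    by (simp only: of_real_eq_iff) (simp add: power2_eq_iff_nonneg)
qed

lemma conjg_of_real [simp]: "conjg (of_real r) = (of_real r :: 'k::real_or_complex)"
proof (cases "r = 0")
  case False
  have "(of_real r :: 'k) * conjg (of_real r) = of_real r * of_real r"
    by (simp add: mult_conjg power2_eq_square)
  with False show ?thesis by simp
qed simp

lemma conjg_numeral [simp]: "conjg (numeral n) = (numeral n :: 'k::real_or_complex)"
  using conjg_of_real[of "numeral n"] by simp

section \<open>Metrics that agree on the carrier\<close>

text \<open>Balls only contain carrier points. This form is needed because \<open>ip_dist\<close> on
  a product and \<open>prod_dist\<close> can differ off the carrier, where \<open>ip_dist\<close> is
  0 by convention.\<close>

lemma mtopology_cong:
  assumes "Metric_space M d" "Metric_space M d'"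
    and "\<And>x y. x \<in> M \<Longrightarrow> y \<in> M \<Longrightarrow> d x y = d' x y"
  shows "Metric_space.mtopology M d = Metric_space.mtopology M d'"
proof -
  have "Metric_space.mball M d = Metric_space.mball M d'"
    using assms(3) by (auto simp: Metric_space.mball_def[OF assms(1)] Metric_space.mball_def[OF assms(2)] fun_eq_iff)
  then have "Metric_space.mopen M d = Metric_space.mopen M d'"
    by (intro ext) (simp add: Metric_space.mopen_def[OF assms(1)] Metric_space.mopen_def[OF assms(2)])
  then show ?thesis
    by (simp add: Metric_space.mtopology_def[OF assms(1)] Metric_space.mtopology_def[OF assms(2)])
qed

lemma mcomplete_cong:
  assumes "Metric_space M d" "Metric_space M d'"
    and "\<And>x y. x \<in> M \<Longrightarrow> y \<in> M \<Longrightarrow> d x y = d' x y"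
  shows "Metric_space.mcomplete M d = Metric_space.mcomplete M d'"
proof -
  have "Metric_space.MCauchy M d \<sigma> = Metric_space.MCauchy M d' \<sigma>" for \<sigma> :: "nat \<Rightarrow> 'a"
  \<comment> \<open>\<open>MCauchy\<close> includes that the range lies in M, so a sequence leaving
    M is Cauchy for neither metric.\<close>
  proof (cases "range \<sigma> \<subseteq> M")
    case True
    then have "d (\<sigma> n) (\<sigma> m) = d' (\<sigma> n) (\<sigma> m)" for n m
      by (intro assms(3)) auto
    then show ?thesis
      by (simp add: Metric_space.MCauchy_def[OF assms(1)] Metric_space.MCauchy_def[OF assms(2)])
  qed (simp add: Metric_space.MCauchy_def[OF assms(1)] Metric_space.MCauchy_def[OF assms(2)])
  then show ?thesis
    by (simp add: Metric_space.mcomplete_def[OF assms(1)] Metric_space.mcomplete_def[OF assms(2)]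
        mtopology_cong[OF assms])
qed

section \<open>Pre-Hilbert spaces on a carrier\<close>

locale pre_hilbert =
  fixes V :: "('k::real_or_complex, 'v::ab_group_add) inner_space"
  assumes pre_hilbert: "pre_hilbert_space V"
begin

sublocale vector_space "scl V"
  using pre_hilbert by (simp add: pre_hilbert_space_def)

lemma subspace_carr: "subspace (carr V)"
  using pre_hilbert by (simp add: pre_hilbert_space_def)

lemmas carr_0 [simp] = subspace_0[OF subspace_carr]
  and carr_add [simp] = subspace_add[OF subspace_carr]
  and carr_scl [simp] = subspace_scale[OF subspace_carr]
  and carr_neg [simp] = subspace_neg[OF subspace_carr]
  and carr_diff [simp] = subspace_diff[OF subspace_carr]

lemmas ip_axioms = pre_hilbert[unfolded pre_hilbert_space_def, THEN conjunct2, THEN conjunct2]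

lemma ip_add_left: "\<lbrakk>x \<in> carr V; y \<in> carr V; z \<in> carr V\<rbrakk> \<Longrightarrow> ip V (x + y) z = ip V x z + ip V y z"
  using ip_axioms[THEN conjunct1] by blast

lemma ip_scl_left: "\<lbrakk>x \<in> carr V; z \<in> carr V\<rbrakk> \<Longrightarrow> ip V (scl V a x) z = a * ip V x z"
  using ip_axioms[THEN conjunct2, THEN conjunct1] by blast

lemma ip_commute: "\<lbrakk>x \<in> carr V; y \<in> carr V\<rbrakk> \<Longrightarrow> ip V y x = conjg (ip V x y)"
  using ip_axioms[THEN conjunct2, THEN conjunct2, THEN conjunct1] by blast

lemma ip_pos: "\<lbrakk>x \<in> carr V; x \<noteq> 0\<rbrakk> \<Longrightarrow> \<exists>r>0. ip V x x = of_real r"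
  using ip_axioms[THEN conjunct2, THEN conjunct2, THEN conjunct2] by blast

lemma ip_add_right: "\<lbrakk>x \<in> carr V; y \<in> carr V; z \<in> carr V\<rbrakk> \<Longrightarrow> ip V z (x + y) = ip V z x + ip V z y"
  using ip_commute[of "x + y" z] ip_commute[of x z] ip_commute[of y z]
  by (simp add: ip_add_left conjg_add)

lemma ip_scl_right: "\<lbrakk>x \<in> carr V; z \<in> carr V\<rbrakk> \<Longrightarrow> ip V z (scl V a x) = conjg a * ip V z x"
  using ip_commute[of "scl V a x" z] ip_commute[of x z] by (simp add: ip_scl_left conjg_mult)

lemma ip_0_left [simp]: "z \<in> carr V \<Longrightarrow> ip V 0 z = 0"
  using ip_scl_left[of 0 z 0] by simp

lemma ip_0_right [simp]: "z \<in> carr V \<Longrightarrow> ip V z 0 = 0"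
  using ip_scl_right[of 0 z 0] by simp

lemma ip_neg_left [simp]: "\<lbrakk>x \<in> carr V; z \<in> carr V\<rbrakk> \<Longrightarrow> ip V (- x) z = - ip V x z"
  using ip_scl_left[of x z "- 1"] by simp

lemma ip_neg_right [simp]: "\<lbrakk>x \<in> carr V; z \<in> carr V\<rbrakk> \<Longrightarrow> ip V z (- x) = - ip V z x"
  using ip_commute[of "- x" z] ip_commute[of x z] by (simp add: conjg_minus)

lemma ip_diff_left: "\<lbrakk>x \<in> carr V; y \<in> carr V; z \<in> carr V\<rbrakk> \<Longrightarrow> ip V (x - y) z = ip V x z - ip V y z"
  using ip_add_left[of x "- y" z] by simp

lemma ip_diff_right: "\<lbrakk>x \<in> carr V; y \<in> carr V; z \<in> carr V\<rbrakk> \<Longrightarrow> ip V z (x - y) = ip V z x - ip V z y"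
  using ip_add_right[of x "- y" z] by simp

section \<open>Squared norm and Cauchy-Schwarz inequality\<close>

text \<open>The form is scalar-valued; taking the norm of the scalar yields a real number that is
  nonnegative everywhere and represents \<open>ip V x x\<close> on the carrier.\<close>

definition sqnorm :: "'v \<Rightarrow> real" where "sqnorm x = norm (ip V x x)"

lemma sqnorm_nonneg [simp]: "0 \<le> sqnorm x"
  by (simp add: sqnorm_def)

lemma ip_self: "x \<in> carr V \<Longrightarrow> ip V x x = of_real (sqnorm x)"
  using ip_pos[of x] by (cases "x = 0") (auto simp: sqnorm_def)

lemma sqnorm_eq_0_iff: "x \<in> carr V \<Longrightarrow> sqnorm x = 0 \<longleftrightarrow> x = 0"
  using ip_pos[of x] by (cases "x = 0") (auto simp: sqnorm_def)

lemma sqnorm_neg [simp]: "x \<in> carr V \<Longrightarrow> sqnorm (- x) = sqnorm x"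
  by (simp add: sqnorm_def)

lemma sqnorm_scl: "x \<in> carr V \<Longrightarrow> sqnorm (scl V a x) = (norm a)\<^sup>2 * sqnorm x"
  by (simp add: sqnorm_def ip_scl_left ip_scl_right norm_mult power2_eq_square)

lemma parallelogram:
  assumes "x \<in> carr V" "y \<in> carr V"
  shows "sqnorm (x + y) + sqnorm (x - y) = 2 * sqnorm x + 2 * sqnorm y"
proof -
  have "(of_real (sqnorm (x + y) + sqnorm (x - y)) :: 'k) = of_real (2 * sqnorm x + 2 * sqnorm y)"
    using assms by (simp add: ip_self[symmetric] ip_add_left ip_add_right ip_diff_left ip_diff_right)
  then show ?thesis by (simp only: of_real_eq_iff)
qed

text \<open>Pythagoras: the subtracted vector is the orthogonal projection of x onto the line
  spanned by y.\<close>

lemma sqnorm_residual: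
  assumes "x \<in> carr V" "y \<in> carr V" "y \<noteq> 0"
  shows "sqnorm (x - scl V (ip V x y / ip V y y) y) = sqnorm x - (norm (ip V x y))\<^sup>2 / sqnorm y"
proof -
  define a where "a = ip V x y / ip V y y"
  have y: "ip V y y \<noteq> 0" using assms sqnorm_eq_0_iff[of y] by (simp add: sqnorm_def)
  \<comment> \<open>By the choice of a, the last bracket in the expansion below vanishes.\<close>
  have ay: "a * ip V y y = ip V x y" using y by (simp add: a_def)
  have "ip V (x - scl V a y) (x - scl V a y)
      = ip V x x - a * ip V y x - conjg a * (ip V x y - a * ip V y y)"
    using assms by (simp add: ip_diff_left ip_diff_right ip_scl_left ip_scl_right algebra_simps)
  also have "\<dots> = ip V x x - (ip V x y * conjg (ip V x y)) / ip V y y"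
    using ip_commute[of x y] assms by (simp add: ay) (simp add: a_def)
  finally have "(of_real (sqnorm (x - scl V a y)) :: 'k)
      = of_real (sqnorm x - (norm (ip V x y))\<^sup>2 / sqnorm y)"
    using assms by (simp add: ip_self mult_conjg)
  then show ?thesis by (simp only: of_real_eq_iff a_def)
qed

text \<open>The residual of x after projection onto y has nonnegative squared norm.\<close>

lemma Cauchy_Schwarz:
  assumes "x \<in> carr V" "y \<in> carr V"
  shows "norm (ip V x y) \<le> sqrt (sqnorm x) * sqrt (sqnorm y)"
proof (cases "y = 0")
  case False
  have "sqnorm y > 0" using False assms(2) sqnorm_eq_0_iff[of y] sqnorm_nonneg[of y] by linarith
  moreover have "0 \<le> sqnorm x - (norm (ip V x y))\<^sup>2 / sqnorm y"
    by (metis False assms sqnorm_nonneg sqnorm_residual)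
  ultimately have "(norm (ip V x y))\<^sup>2 \<le> sqnorm x * sqnorm y"
    by (simp add: field_simps)
  then show ?thesis
    by (simp add: real_le_rsqrt flip: real_sqrt_mult)
qed (use assms in simp)

lemma sqrt_sqnorm_triangle:
  assumes "x \<in> carr V" "y \<in> carr V"
  shows "sqrt (sqnorm (x + y)) \<le> sqrt (sqnorm x) + sqrt (sqnorm y)"
proof (rule real_le_lsqrt)
  have "sqnorm (x + y) = norm (ip V x x + ip V x y + (ip V y x + ip V y y))"
    unfolding sqnorm_def using assms by (simp add: ip_add_left ip_add_right algebra_simps)
  also have "\<dots> \<le> sqnorm x + norm (ip V x y) + (norm (ip V y x) + sqnorm y)"
    unfolding sqnorm_def by (intro norm_triangle_mono) auto
  also have "\<dots> \<le> sqnorm x + sqrt (sqnorm x) * sqrt (sqnorm y) + (sqrt (sqnorm y) * sqrt (sqnorm x) + sqnorm y)"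
    using Cauchy_Schwarz[of x y] Cauchy_Schwarz[of y x] assms by (simp add: mult.commute)
  also have "\<dots> = (sqrt (sqnorm x) + sqrt (sqnorm y))\<^sup>2"
    by (simp add: power2_sum)
  finally show "sqnorm (x + y) \<le> (sqrt (sqnorm x) + sqrt (sqnorm y))\<^sup>2" .
qed simp

section \<open>The induced metric and continuity of the inner product\<close>

lemma ip_dist: "\<lbrakk>x \<in> carr V; y \<in> carr V\<rbrakk> \<Longrightarrow> ip_dist V x y = sqrt (sqnorm (x - y))"
  by (simp add: ip_dist_def sqnorm_def)

sublocale Metric_space "carr V" "ip_dist V"
proof
  fix x y z
  show "0 \<le> ip_dist V x y" by (simp add: ip_dist_def)
  show "ip_dist V x y = ip_dist V y x"
    using sqnorm_neg[of "x - y"] by (auto simp: ip_dist_def sqnorm_def)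
  assume *: "x \<in> carr V" "y \<in> carr V"
  then show "ip_dist V x y = 0 \<longleftrightarrow> x = y"
    by (simp add: ip_dist sqnorm_eq_0_iff)
  assume "z \<in> carr V"
  with * show "ip_dist V x z \<le> ip_dist V x y + ip_dist V y z"
    using sqrt_sqnorm_triangle[of "x - y" "y - z"] by (simp add: ip_dist)
qed

lemma in_closureE:
  assumes "p \<in> ip_topology V closure_of S" "e > 0"
  obtains s where "s \<in> S" "s \<in> carr V" "p \<in> carr V" "sqrt (sqnorm (p - s)) < e"
proof -
  have p: "p \<in> carr V" and "\<exists>s\<in>S. s \<in> mball p e"
    using assms by (simp_all add: ip_topology_def metric_closure_of)
  then obtain s where "s \<in> S" "s \<in> mball p e" by blast
  with p show thesis by (intro that[of s]) (auto simp: ip_dist)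
qed

text \<open>An explicit radius for the continuity of the form at 0 in its first argument; the
  summand 1 keeps the denominator positive for z = 0.\<close>

lemma norm_ip_le_if_sqnorm_less:
  assumes "x \<in> carr V" "z \<in> carr V" "e > 0" "sqrt (sqnorm x) < e / (sqrt (sqnorm z) + 1)"
  shows "norm (ip V x z) \<le> e"
proof -
  have "norm (ip V x z) \<le> sqrt (sqnorm x) * sqrt (sqnorm z)"
    by (rule Cauchy_Schwarz) (use assms in auto)
  also have "\<dots> \<le> e / (sqrt (sqnorm z) + 1) * (sqrt (sqnorm z) + 1)"
    using assms by (intro mult_mono) auto
  also have "\<dots> = e"
    using add_nonneg_pos[of "sqrt (sqnorm z)" 1] by simp
  finally show ?thesis .
qed

text \<open>If s in S is close to p, then \<open>ip V p z = ip V (p - s) z\<close> is small by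
  Cauchy-Schwarz.\<close>

lemma orthogonal_closure_of:
  assumes "z \<in> carr V" "\<And>s. s \<in> S \<Longrightarrow> ip V s z = 0" "p \<in> ip_topology V closure_of S"
  shows "ip V p z = 0"
proof -
  have "norm (ip V p z) \<le> e" if "e > 0" for e
  proof -
    have "e / (sqrt (sqnorm z) + 1) > 0" using that by (simp add: add_nonneg_pos)
    with assms(3) obtain s where s: "s \<in> S" "s \<in> carr V" "p \<in> carr V"
      "sqrt (sqnorm (p - s)) < e / (sqrt (sqnorm z) + 1)"
      by (rule in_closureE)
    then have "norm (ip V (p - s) z) \<le> e"
      using norm_ip_le_if_sqnorm_less[of "p - s" z e] assms(1) that by simp
    with s assms show ?thesis by (simp add: ip_diff_left)
  qed
  then have "norm (ip V p z) \<le> 0" by (rule field_le_epsilon) simp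
  then show ?thesis by simp
qed

section \<open>Orthogonal projection onto the closure of a subspace\<close>

text \<open>A minimizing sequence in \<open>M\<close> is Cauchy by the parallelogram law; near-minimality also
  makes its residuals almost orthogonal to \<open>M\<close>, so the limit needs no minimality argument.\<close>

lemma ex_orthogonal_projection:
  assumes complete: mcomplete and M: "subspace M" "M \<subseteq> carr V" and x: "x \<in> carr V"
  shows "\<exists>p \<in> ip_topology V closure_of M. \<forall>m\<in>M. ip V (x - p) m = 0"
proof -
  define d where "d = (INF m\<in>M. sqnorm (x - m))"
  have ne: "M \<noteq> {}" using subspace_0[OF M(1)] by auto
  have bdd: "bdd_below ((\<lambda>m. sqnorm (x - m)) ` M)"
    by (rule bdd_belowI[of _ 0]) auto
  have d_le: "d \<le> sqnorm (x - m)" if "m \<in> M" for m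
    unfolding d_def using that bdd by (rule cINF_lower[rotated])
  have "\<exists>m\<in>M. sqnorm (x - m) < d + 1 / Suc n" for n
    using cINF_less_iff[OF ne bdd, of "d + 1 / Suc n"] by (simp add: d_def)
  then obtain m where m: "\<And>n. m n \<in> M" "\<And>n. sqnorm (x - m n) < d + 1 / Suc n" by metis
  have mc [simp]: "m n \<in> carr V" for n using m(1) M(2) by auto
  have half: "scl V (1/2) (u + u) = u" for u
    by (simp add: scale_right_distrib flip: scale_left_distrib)
  have dist_m: "sqnorm (m i - m j) \<le> 2 / Suc i + 2 / Suc j" for i j
  proof -
    \<comment> \<open>The midpoint c lies in M, so its squared distance from x is at least d. In the
      parallelogram law the multiples of d then cancel, and only the errors \<open>1 / Suc i\<close>
      and \<open>1 / Suc j\<close> remain, doubled.\<close>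
    define c where "c = scl V (1/2) (m i + m j)"
    have "c \<in> M" unfolding c_def by (intro subspace_scale subspace_add M m)
    have [simp]: "c \<in> carr V" by (simp add: c_def)
    have "c + c = m i + m j" unfolding c_def by (metis half scale_right_distrib)
    then have eq: "(x - m i) + (x - m j) = scl V 2 (x - c)"
      using scale_left_distrib[of 1 1 "x - c"] by (simp add: algebra_simps)
    have "sqnorm ((x - m i) + (x - m j)) = 4 * sqnorm (x - c)"
      unfolding eq using x by (subst sqnorm_scl) auto
    moreover have "sqnorm ((x - m i) + (x - m j)) + sqnorm ((x - m i) - (x - m j))
        = 2 * sqnorm (x - m i) + 2 * sqnorm (x - m j)"
      using x by (intro parallelogram) auto
    moreover have "(x - m i) - (x - m j) = - (m i - m j)" by simp
    ultimately have "sqnorm (m i - m j) = 2 * sqnorm (x - m i) + 2 * sqnorm (x - m j) - 4 * sqnorm (x - c)"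
      using sqnorm_neg[of "m i - m j"] by simp
    with d_le[OF \<open>c \<in> M\<close>] m(2)[of i] m(2)[of j] show ?thesis by simp
  qed
  have "MCauchy m"
    unfolding MCauchy_def
  proof safe
    fix e :: real assume "e > 0"
    \<comment> \<open>For indices from N on, each of the two summands in \<open>dist_m\<close> is
      below half of \<open>e\<^sup>2\<close>.\<close>
    then obtain N where N: "inverse (real (Suc N)) < e\<^sup>2 / 4"
      using reals_Archimedean[of "e\<^sup>2 / 4"] by auto
    have "ip_dist V (m i) (m j) < e" if "N \<le> i" "N \<le> j" for i j
    proof -
      have "1 / real (Suc i) \<le> inverse (real (Suc N))" "1 / real (Suc j) \<le> inverse (real (Suc N))"
        using that by (auto simp: divide_simps)
      with N dist_m[of i j] have "sqnorm (m i - m j) < e\<^sup>2" by simp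
      with \<open>e > 0\<close> show ?thesis
        by (simp add: ip_dist real_less_lsqrt)
    qed
    then show "\<exists>N. \<forall>i j. N \<le> i \<longrightarrow> N \<le> j \<longrightarrow> ip_dist V (m i) (m j) < e" by blast
  qed auto
  with complete obtain p where lim: "limitin mtopology m p sequentially"
    unfolding mcomplete_def by blast
  have "p \<in> ip_topology V closure_of M"
    unfolding ip_topology_def closure_of_sequentially
    using lim m(1) by (auto simp: limit_metric_sequentially intro!: exI[of _ m])
  then have [simp]: "p \<in> carr V" by (rule in_closureE[of _ _ 1]) auto
  have near: "(norm (ip V (x - m n) y))\<^sup>2 \<le> sqnorm y / Suc n" if y: "y \<in> M" for n y
  proof (cases "y = 0")
    case False
    have [simp]: "y \<in> carr V" using y M(2) by auto
    have pos: "sqnorm y > 0" using False sqnorm_eq_0_iff[of y] sqnorm_nonneg[of y] \<open>y \<in> carr V\<close>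
      by linarith
    \<comment> \<open>Moving \<open>m n\<close> by this multiple of y stays in M, so the squared
      distance to x cannot fall below d. By \<open>sqnorm_residual\<close> the move lowers it by the
      quotient below, which is therefore at most \<open>1 / Suc n\<close>.\<close>
    define a where "a = ip V (x - m n) y / ip V y y"
    have "m n + scl V a y \<in> M" by (intro subspace_scale subspace_add M m y)
    then have "d \<le> sqnorm (x - m n - scl V a y)" using d_le by (metis diff_diff_eq)
    also have "\<dots> = sqnorm (x - m n) - (norm (ip V (x - m n) y))\<^sup>2 / sqnorm y"
      unfolding a_def using x False by (intro sqnorm_residual) auto
    finally have "(norm (ip V (x - m n) y))\<^sup>2 / sqnorm y \<le> 1 / Suc n" using m(2)[of n] by simp
    then show ?thesis using pos by (simp add: pos_divide_le_eq)
  qed (use x in simp)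
  have "ip V (x - p) y = 0" if y: "y \<in> M" for y
  proof -
    have [simp]: "y \<in> carr V" using y M(2) by auto
    have small: "norm (ip V (x - p) y) \<le> e + e" if "e > 0" for e
    proof -
      \<comment> \<open>This one radius serves both error terms: it fits
        \<open>norm_ip_le_if_sqnorm_less\<close>, and \<open>sqrt (sqnorm y) * e'\<close> is at most
        e.\<close>
      define e' where "e' = e / (sqrt (sqnorm y) + 1)"
      have "e' > 0" using that by (simp add: e'_def add_nonneg_pos)
      then obtain N where N: "\<And>n. n \<ge> N \<Longrightarrow> ip_dist V (m n) p < e'"
        using lim by (auto simp: limit_metric_sequentially)
      obtain k where k: "inverse (real (Suc k)) < e'\<^sup>2"
        using reals_Archimedean[of "e'\<^sup>2"] \<open>e' > 0\<close> by auto
      \<comment> \<open>N makes \<open>m n\<close> close to p, and k makes the residual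
        \<open>x - m n\<close> nearly orthogonal to y.\<close>
      define n where "n = max N k"
      have "sqrt (sqnorm (m n - p)) < e'" using N[of n] by (simp add: ip_dist n_def)
      then have 1: "norm (ip V (m n - p) y) \<le> e"
        using that norm_ip_le_if_sqnorm_less[of "m n - p" y e] by (simp add: e'_def)
      have "1 / real (Suc n) \<le> inverse (real (Suc k))" by (auto simp: divide_simps n_def)
      then have "sqnorm y / Suc n \<le> sqnorm y * e'\<^sup>2"
        using k mult_left_mono[of "1 / real (Suc n)" "e'\<^sup>2" "sqnorm y"] by simp
      with near[OF y, of n] have "(norm (ip V (x - m n) y))\<^sup>2 \<le> (sqrt (sqnorm y) * e')\<^sup>2"
        by (simp add: power_mult_distrib)
      then have "norm (ip V (x - m n) y) \<le> sqrt (sqnorm y) * e'"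
        using \<open>e' > 0\<close> by (auto intro: power2_le_imp_le)
      also have "\<dots> \<le> (sqrt (sqnorm y) + 1) * e'" using \<open>e' > 0\<close> by simp
      also have "\<dots> = e" using add_nonneg_pos[of "sqrt (sqnorm y)" 1] by (simp add: e'_def)
      finally have 2: "norm (ip V (x - m n) y) \<le> e" .
      have "ip V (x - p) y = ip V (x - m n) y + ip V (m n - p) y"
        using x by (simp add: ip_diff_left)
      with 1 2 show ?thesis by (metis norm_triangle_mono)
    qed
    have "norm (ip V (x - p) y) \<le> 0"
      by (rule field_le_epsilon) (use small[of "e / 2" for e] in simp)
    then show ?thesis by simp
  qed
  with \<open>p \<in> ip_topology V closure_of M\<close> show ?thesis by blast
qed

end

section \<open>Products\<close>

text \<open>The Hilbert sum, in which graphs of operators live; on the graph of an operator in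
  \<open>prod_space V V\<close> its form is the graph inner product.\<close>

definition prod_space ::
  "('k::real_or_complex, 'v::ab_group_add) inner_space \<Rightarrow> ('k, 'w::ab_group_add) inner_space \<Rightarrow>
   ('k, 'v \<times> 'w) inner_space" where
  "prod_space V W = \<lparr>carr = carr V \<times> carr W, scl = (\<lambda>a (x, y). (scl V a x, scl W a y)),
     ip = (\<lambda>(x, y) (x', y'). ip V x x' + ip W y y')\<rparr>"

lemma prod_space_simps [simp]:
  "carr (prod_space V W) = carr V \<times> carr W"
  "scl (prod_space V W) a (x, y) = (scl V a x, scl W a y)"
  "ip (prod_space V W) (x, y) (x', y') = ip V x x' + ip W y y'"
  by (simp_all add: prod_space_def)

locale pre_hilbert_pair = V: pre_hilbert V + W: pre_hilbert W
  for V :: "('k::real_or_complex, 'v::ab_group_add) inner_space"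
    and W :: "('k, 'w::ab_group_add) inner_space"
begin

lemma pre_hilbert_space_prod: "pre_hilbert_space (prod_space V W)"
proof -
  interpret P: vector_space "scl (prod_space V W)"
    by standard (auto simp: V.scale_right_distrib W.scale_right_distrib
        V.scale_left_distrib W.scale_left_distrib)
  have pos: "\<exists>r>0. ip V x x + ip W y y = of_real r"
    if "x \<in> carr V" "y \<in> carr W" "x = 0 \<longrightarrow> y \<noteq> 0" for x y
  proof (intro exI conjI)
    show "ip V x x + ip W y y = of_real (V.sqnorm x + W.sqnorm y)"
      using that by (simp add: V.ip_self W.ip_self)
    show "V.sqnorm x + W.sqnorm y > 0"
      using that V.sqnorm_eq_0_iff[of x] W.sqnorm_eq_0_iff[of y] V.sqnorm_nonneg[of x] W.sqnorm_nonneg[of y]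
      by linarith
  qed
  show ?thesis
    unfolding pre_hilbert_space_def
  proof (intro conjI P.vector_space_axioms)
    show "P.subspace (carr (prod_space V W))"
      by (auto simp: P.subspace_def zero_prod_def)
    show "\<forall>x\<in>carr (prod_space V W). \<forall>y\<in>carr (prod_space V W).
        ip (prod_space V W) y x = conjg (ip (prod_space V W) x y)"
      by (auto simp: conjg_add simp flip: V.ip_commute W.ip_commute)
  qed (auto simp: V.ip_add_left W.ip_add_left V.ip_scl_left W.ip_scl_left
      algebra_simps zero_prod_def intro!: pos)
qed

sublocale P: pre_hilbert "prod_space V W"
  by (rule pre_hilbert.intro[OF pre_hilbert_space_prod])

sublocale M: Metric_space12 "carr V" "ip_dist V" "carr W" "ip_dist W"
  by unfold_locales

text \<open>\<open>prod_dist\<close> is the Euclidean combination of the two metrics, matching the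
  sum of the two squared norms.\<close>

lemma ip_dist_prod_space:
  assumes "p \<in> carr V \<times> carr W" "q \<in> carr V \<times> carr W"
  shows "ip_dist (prod_space V W) p q = prod_dist (ip_dist V) (ip_dist W) p q"
proof -
  obtain x y x' y' where [simp]: "p = (x, y)" "q = (x', y')" by (metis surj_pair)
  have *: "x \<in> carr V" "x' \<in> carr V" "y \<in> carr W" "y' \<in> carr W" using assms by auto
  have "P.sqnorm (p - q) = norm (of_real (V.sqnorm (x - x') + W.sqnorm (y - y')) :: 'k)"
    using * by (simp add: P.sqnorm_def V.ip_self W.ip_self)
  also have "\<dots> = V.sqnorm (x - x') + W.sqnorm (y - y')"
    unfolding norm_of_real by simp
  finally show ?thesis
    using * by (simp add: P.ip_dist V.ip_dist W.ip_dist prod_dist_def)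
qed

text \<open>Links the product topology in \<open>op_closure\<close> to the inner product on pairs,
  so that the closure of a graph can be handled by orthogonality.\<close>

lemma ip_topology_prod_space:
  "ip_topology (prod_space V W) = prod_topology (ip_topology V) (ip_topology W)"
  unfolding ip_topology_def M.mtopology_prod_metric[symmetric] prod_space_simps
  using P.Metric_space_axioms
  by (intro mtopology_cong M.Prod_metric.Metric_space_axioms ip_dist_prod_space) auto

lemma mcomplete_prod_space:
  assumes V.mcomplete W.mcomplete
  shows P.mcomplete
proof -
  have "M.Prod_metric.mcomplete" using assms M.mcomplete_prod_metric by blast
  moreover have "P.mcomplete = M.Prod_metric.mcomplete"
    unfolding prod_space_simps
    using P.Metric_space_axioms
    by (intro mcomplete_cong M.Prod_metric.Metric_space_axioms ip_dist_prod_space) auto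
  ultimately show ?thesis by simp
qed

end

section \<open>The boundary form of a skew-symmetric operator\<close>

text \<open>Serves for \<open>H_plus\<close> and \<open>H_minus\<close>, where the graph inner
  product is twice the form of V on the respective kernel.\<close>

lemma (in pre_hilbert) pre_hilbert_space_scaled:
  assumes "subspace K" "K \<subseteq> carr V" "c > 0"
    and "\<And>u v. u \<in> K \<Longrightarrow> v \<in> K \<Longrightarrow> f u v = of_real c * ip V u v"
  shows "pre_hilbert_space \<lparr>carr = K, scl = scl V, ip = f\<rparr>"
proof -
  have c: "x \<in> carr V" if "x \<in> K" for x using that assms(2) by auto
  have add: "f (x + y) z = f x z + f y z" if "x \<in> K" "y \<in> K" "z \<in> K" for x y z
    using that c subspace_add[OF assms(1)] by (simp add: assms(4) ip_add_left distrib_left)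
  have scl: "f (scl V a x) z = a * f x z" if "x \<in> K" "z \<in> K" for a x z
    using that c subspace_scale[OF assms(1)] by (simp add: assms(4) ip_scl_left)
  have commute: "f y x = conjg (f x y)" if "x \<in> K" "y \<in> K" for x y
    using that c by (simp add: assms(4) conjg_mult flip: ip_commute)
  have pos: "\<exists>r>0. f x x = of_real r" if "x \<in> K" "x \<noteq> 0" for x
  proof -
    have "\<exists>r>0. ip V x x = of_real r" using that c by (intro ip_pos)
    then obtain r where "r > 0" "ip V x x = of_real r" by blast
    then show ?thesis using that assms(3) by (intro exI[of _ "c * r"]) (simp add: assms(4))
  qed
  show ?thesis
    unfolding pre_hilbert_space_def inner_space.simps
    using vector_space_axioms assms(1) add scl commute pos by blast
qed

locale skew_symmetric_operator = pre_hilbert V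
  for V :: "('k::real_or_complex, 'v::ab_group_add) inner_space" +
  fixes A0 :: "'v oper"
  assumes operator: "operator_on V A0"
    and dense: "densely_defined V A0"
    and skew: "skew_symmetric V A0"
begin

sublocale VV: pre_hilbert_pair V V ..

definition A :: "'v oper" where "A = max_op V A0"

section \<open>The maximal operator \<open>A\<close>\<close>

lemma dom_A0_carr [simp]: "u \<in> op_dom A0 \<Longrightarrow> u \<in> carr V"
  and app_A0_carr [simp]: "u \<in> op_dom A0 \<Longrightarrow> op_app A0 u \<in> carr V"
  and subspace_dom_A0: "subspace (op_dom A0)"
  and app_A0_add: "\<lbrakk>u \<in> op_dom A0; v \<in> op_dom A0\<rbrakk> \<Longrightarrow> op_app A0 (u + v) = op_app A0 u + op_app A0 v"
  and app_A0_scl: "u \<in> op_dom A0 \<Longrightarrow> op_app A0 (scl V c u) = scl V c (op_app A0 u)"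
  using operator by (auto simp: operator_on_def linear_map_on_def)

text \<open>By density z lies in the closure of the domain, hence is orthogonal to itself.\<close>

lemma eq_0_if_orthogonal_dom_A0:
  assumes "z \<in> carr V" "\<And>u. u \<in> op_dom A0 \<Longrightarrow> ip V u z = 0"
  shows "z = 0"
proof -
  have "ip V z z = 0"
    by (rule orthogonal_closure_of[where S = "op_dom A0"])
      (use assms dense in \<open>simp_all add: densely_defined_def\<close>)
  then show ?thesis
    using assms(1) sqnorm_eq_0_iff[of z] by (simp add: sqnorm_def)
qed

text \<open>Density makes the adjoint relation single-valued, so the \<open>THE\<close> in
  \<open>op_of_graph\<close> returns its value. Treating domain and value together lets later proofs
  establish both by one check against \<open>A0\<close>.\<close>

lemma A_iff:
  "v \<in> op_dom A \<and> op_app A v = w \<longleftrightarrow>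
     v \<in> carr V \<and> w \<in> carr V \<and> (\<forall>u\<in>op_dom A0. ip V (op_app A0 u) v + ip V u w = 0)"
proof -
  define S where "S = {(v, w). v \<in> carr V \<and> w \<in> carr V \<and>
       (\<forall>u\<in>op_dom A0. ip V (op_app A0 u) v = ip V u w)}"
  have unique: "y = z" if "(x, y) \<in> S" "(x, z) \<in> S" for x y z
  proof -
    have "y - z = 0"
    proof (rule eq_0_if_orthogonal_dom_A0)
      show "ip V u (y - z) = 0" if "u \<in> op_dom A0" for u
      proof -
        have "ip V u y = ip V u z"
          using \<open>(x, y) \<in> S\<close> \<open>(x, z) \<in> S\<close> that unfolding S_def by force
        then show ?thesis
          using \<open>(x, y) \<in> S\<close> \<open>(x, z) \<in> S\<close> that by (simp add: S_def ip_diff_right)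
      qed
    qed (use that in \<open>simp add: S_def\<close>)
    then show ?thesis by simp
  qed
  have A_S: "op_dom A = Domain S" "op_app A v = - (THE w. (v, w) \<in> S)"
    by (simp_all add: A_def max_op_def op_uminus_def op_adjoint_def op_of_graph_def S_def)
  \<comment> \<open>\<open>S\<close> is the graph of the adjoint; \<open>A\<close> is its negative,
    hence the sign of w.\<close>
  have "v \<in> op_dom A \<and> op_app A v = w \<longleftrightarrow> (v, - w) \<in> S"
  proof
    assume "v \<in> op_dom A \<and> op_app A v = w"
    moreover then obtain y where y: "(v, y) \<in> S" by (auto simp: A_S)
    moreover have "(THE w. (v, w) \<in> S) = y" using y unique by blast
    ultimately show "(v, - w) \<in> S" by (auto simp: A_S)
  next
    assume *: "(v, - w) \<in> S"
    moreover have "(THE w. (v, w) \<in> S) = - w" using * unique by blast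
    ultimately show "v \<in> op_dom A \<and> op_app A v = w" by (auto simp: A_S)
  qed
  also have "\<dots> \<longleftrightarrow> v \<in> carr V \<and> w \<in> carr V \<and> (\<forall>u\<in>op_dom A0. ip V (op_app A0 u) v + ip V u w = 0)"
  proof -
    have "- w \<in> carr V \<longleftrightarrow> w \<in> carr V" using carr_neg[of w] carr_neg[of "- w"] by auto
    then show ?thesis by (auto simp: S_def eq_neg_iff_add_eq_0)
  qed
  finally show ?thesis .
qed

lemma A_carr [simp]: "v \<in> op_dom A \<Longrightarrow> v \<in> carr V" "v \<in> op_dom A \<Longrightarrow> op_app A v \<in> carr V"
  using A_iff[of v "op_app A v"] by auto

lemma A_adjoint: "\<lbrakk>v \<in> op_dom A; u \<in> op_dom A0\<rbrakk> \<Longrightarrow> ip V (op_app A0 u) v + ip V u (op_app A v) = 0"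
  using A_iff[of v "op_app A v"] by auto

lemma A_add:
  assumes "u \<in> op_dom A" "v \<in> op_dom A"
  shows "u + v \<in> op_dom A \<and> op_app A (u + v) = op_app A u + op_app A v"
proof -
  have "ip V (op_app A0 x) (u + v) + ip V x (op_app A u + op_app A v) = 0" if "x \<in> op_dom A0" for x
  proof -
    have "ip V (op_app A0 x) (u + v) + ip V x (op_app A u + op_app A v)
        = (ip V (op_app A0 x) u + ip V x (op_app A u)) + (ip V (op_app A0 x) v + ip V x (op_app A v))"
      using assms that by (simp add: ip_add_right)
    then show ?thesis using assms that by (simp add: A_adjoint)
  qed
  then show ?thesis using assms unfolding A_iff by simp
qed

lemma A_scl:
  assumes "u \<in> op_dom A"
  shows "scl V c u \<in> op_dom A \<and> op_app A (scl V c u) = scl V c (op_app A u)"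
proof -
  have "ip V (op_app A0 x) (scl V c u) + ip V x (scl V c (op_app A u)) = 0" if "x \<in> op_dom A0" for x
  proof -
    have "ip V (op_app A0 x) (scl V c u) + ip V x (scl V c (op_app A u))
        = conjg c * (ip V (op_app A0 x) u + ip V x (op_app A u))"
      using assms that by (simp add: ip_scl_right distrib_left)
    then show ?thesis using assms that by (simp add: A_adjoint)
  qed
  then show ?thesis using assms unfolding A_iff by simp
qed

lemma A_diff:
  assumes "u \<in> op_dom A" "v \<in> op_dom A"
  shows "u - v \<in> op_dom A \<and> op_app A (u - v) = op_app A u - op_app A v"
  using A_add[OF assms(1) A_scl[OF assms(2), THEN conjunct1, of "- 1"]] A_scl[OF assms(2), of "- 1"]
  by simp

text \<open>Skew-symmetry of \<open>A0\<close> is the condition of \<open>A_iff\<close> for the pair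
  \<open>(u, op_app A0 u)\<close>.\<close>

lemma A_extends_A0: "u \<in> op_dom A0 \<Longrightarrow> u \<in> op_dom A \<and> op_app A u = op_app A0 u"
  using skew unfolding A_iff by (simp add: skew_symmetric_def)

lemma subspace_dom_A: "subspace (op_dom A)"
proof (rule subspaceI)
  show "0 \<in> op_dom A" using A_extends_A0 subspace_0[OF subspace_dom_A0] by blast
qed (auto simp: A_add A_scl)

section \<open>The boundary form and the closure of \<open>A0\<close>\<close>

text \<open>The defect of \<open>A\<close> from skew-symmetry, which a boundary quadruple expresses
  through boundary values.\<close>

definition boundary_form :: "'v \<Rightarrow> 'v \<Rightarrow> 'k" where
  "boundary_form u v = ip V (op_app A u) v + ip V u (op_app A v)"

lemma boundary_form_add_left:
  "\<lbrakk>u \<in> op_dom A; u' \<in> op_dom A; v \<in> op_dom A\<rbrakk> \<Longrightarrow>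
    boundary_form (u + u') v = boundary_form u v + boundary_form u' v"
  by (simp add: boundary_form_def A_add ip_add_left)

lemma boundary_form_scl_left:
  "\<lbrakk>u \<in> op_dom A; v \<in> op_dom A\<rbrakk> \<Longrightarrow> boundary_form (scl V c u) v = c * boundary_form u v"
  by (simp add: boundary_form_def A_scl ip_scl_left distrib_left)

lemma boundary_form_commute:
  assumes "u \<in> op_dom A" "v \<in> op_dom A"
  shows "boundary_form v u = conjg (boundary_form u v)"
proof -
  have "conjg (boundary_form u v) = ip V v (op_app A u) + ip V (op_app A v) u"
    using assms by (simp add: boundary_form_def conjg_add flip: ip_commute)
  then show ?thesis by (simp add: boundary_form_def)
qed

definition graph_closure :: "('v \<times> 'v) set" where
  "graph_closure = prod_topology (ip_topology V) (ip_topology V) closure_of op_graph A0"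

lemma graph_closure_eq: "graph_closure = ip_topology (prod_space V V) closure_of op_graph A0"
  by (simp add: graph_closure_def VV.ip_topology_prod_space)

lemma dom_op_closure: "op_dom (op_closure V A0) = Domain graph_closure"
  by (simp add: op_closure_def op_of_graph_def graph_closure_def)

lemma graph_closure_carr:
  assumes "(x, y) \<in> graph_closure" shows "x \<in> carr V" "y \<in> carr V"
  using assms VV.P.in_closureE[of "(x, y)" "op_graph A0" 1] unfolding graph_closure_eq by auto

text \<open>The adjoint relation says that \<open>(op_app A v, v)\<close>, with its entries swapped,
  is orthogonal to the graph of \<open>A0\<close>; orthogonality to a fixed vector passes to the
  closure.\<close>

lemma graph_closure_orthogonal:
  assumes "(x, y) \<in> graph_closure" "v \<in> op_dom A"
  shows "ip V y v + ip V x (op_app A v) = 0"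
proof -
  have "ip (prod_space V V) (x, y) (op_app A v, v) = 0"
  proof (rule VV.P.orthogonal_closure_of)
    show "ip (prod_space V V) s (op_app A v, v) = 0" if "s \<in> op_graph A0" for s
      using that A_adjoint[OF assms(2)] by (auto simp: op_graph_def add.commute)
  qed (use assms in \<open>auto simp: graph_closure_eq\<close>)
  then show ?thesis by (simp add: add.commute)
qed

text \<open>Testing the previous identity with u in the domain of \<open>A0\<close>, where
  \<open>A\<close> and \<open>A0\<close> agree, and conjugating gives the condition of
  \<open>A_iff\<close>.\<close>

lemma graph_closure_A:
  assumes "(x, y) \<in> graph_closure"
  shows "x \<in> op_dom A \<and> op_app A x = y"
  unfolding A_iff
proof (intro conjI ballI)
  show xy: "x \<in> carr V" "y \<in> carr V" using graph_closure_carr[OF assms] .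
  fix u assume u: "u \<in> op_dom A0"
  have "conjg (ip V y u + ip V x (op_app A0 u)) = 0"
    using graph_closure_orthogonal[OF assms, of u] A_extends_A0[OF u] by simp
  then show "ip V (op_app A0 u) x + ip V u y = 0"
    using xy u by (simp add: conjg_add add.commute flip: ip_commute)
qed

lemma boundary_form_closure_left:
  assumes "u \<in> op_dom (op_closure V A0)" "v \<in> op_dom A"
  shows "u \<in> op_dom A" "boundary_form u v = 0"
  using assms graph_closure_A graph_closure_orthogonal
  by (auto simp: dom_op_closure boundary_form_def)

section \<open>The kernels of Id - \<open>A\<close> and Id + \<open>A\<close>\<close>

abbreviation Kp :: "'v set" where "Kp \<equiv> ker_id_minus A"
abbreviation Km :: "'v set" where "Km \<equiv> ker_id_plus A"

lemma Kp_iff: "u \<in> Kp \<longleftrightarrow> u \<in> op_dom A \<and> op_app A u = u"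
  by (auto simp: ker_id_minus_def)

lemma Km_iff: "u \<in> Km \<longleftrightarrow> u \<in> op_dom A \<and> op_app A u = - u"
  by (auto simp: ker_id_plus_def add_eq_0_iff add.commute)

lemma subspace_Kp: "subspace Kp"
  using subspace_0[OF subspace_dom_A] A_scl[of 0 0]
  by (intro subspaceI) (auto simp: Kp_iff A_add A_scl)

lemma subspace_Km: "subspace Km"
  using subspace_0[OF subspace_dom_A] A_scl[of 0 0]
  by (intro subspaceI) (auto simp: Km_iff A_add A_scl)

text \<open>\<open>A\<close> acts as a sign on each kernel: equal signs make the two terms of the
  form add up, opposite signs make them cancel.\<close>

lemma boundary_form_Kp_Kp: "\<lbrakk>p \<in> Kp; q \<in> Kp\<rbrakk> \<Longrightarrow> boundary_form p q = 2 * ip V p q"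
  and boundary_form_Km_Km: "\<lbrakk>m \<in> Km; n \<in> Km\<rbrakk> \<Longrightarrow> boundary_form m n = - 2 * ip V m n"
  and boundary_form_Kp_Km: "\<lbrakk>p \<in> Kp; m \<in> Km\<rbrakk> \<Longrightarrow> boundary_form p m = 0"
  and boundary_form_Km_Kp: "\<lbrakk>m \<in> Km; p \<in> Kp\<rbrakk> \<Longrightarrow> boundary_form m p = 0"
  by (auto simp: boundary_form_def Kp_iff Km_iff)

text \<open>The component w0 drops out of the form, and the two kernels are orthogonal with respect
  to it, so testing with one kernel isolates the component in that kernel.\<close>

lemma decomposition_boundary_form:
  assumes "is_decomposition V A0 w w0 p m"
  shows "w \<in> op_dom A" "p \<in> Kp" "m \<in> Km"
    and "\<And>q. q \<in> Kp \<Longrightarrow> boundary_form w q = 2 * ip V p q"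
    and "\<And>n. n \<in> Km \<Longrightarrow> boundary_form w n = - 2 * ip V m n"
    and "\<And>v. v \<in> op_dom A \<Longrightarrow> boundary_form w v = boundary_form p v + boundary_form m v"
proof -
  have w: "w = w0 + p + m" and w0: "w0 \<in> op_dom (op_closure V A0)" and p: "p \<in> Kp" and m: "m \<in> Km"
    using assms by (auto simp: is_decomposition_def A_def)
  have dom: "w0 \<in> op_dom A" "p \<in> op_dom A" "m \<in> op_dom A"
    using boundary_form_closure_left[OF w0 subspace_0[OF subspace_dom_A]] p m by (auto simp: Kp_iff Km_iff)
  show "p \<in> Kp" "m \<in> Km" by fact+
  show "w \<in> op_dom A" using dom by (simp add: w A_add)
  show *: "boundary_form w v = boundary_form p v + boundary_form m v" if "v \<in> op_dom A" for v
    using dom that boundary_form_closure_left[OF w0 that] by (simp add: w A_add boundary_form_add_left)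
  show "boundary_form w q = 2 * ip V p q" if "q \<in> Kp" for q
    using that *[of q] p m by (simp add: boundary_form_Kp_Kp boundary_form_Km_Kp) (simp add: Kp_iff)
  show "boundary_form w n = - 2 * ip V m n" if "n \<in> Km" for n
    using that *[of n] p m by (simp add: boundary_form_Km_Km boundary_form_Kp_Km) (simp add: Km_iff)
qed

text \<open>The difference of p and p' lies in K and can be tested against itself.\<close>

lemma eq_if_ip_eq:
  assumes "subspace K" "K \<subseteq> carr V" "p \<in> K" "p' \<in> K" "\<And>q. q \<in> K \<Longrightarrow> ip V p q = ip V p' q"
  shows "p = p'"
proof -
  have "p - p' \<in> K" using assms by (intro subspace_diff)
  then have "ip V (p - p') (p - p') = 0"
    using assms(5) subsetD[OF assms(2)] assms(3,4) by (simp add: ip_diff_left)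
  then have "sqnorm (p - p') = 0" by (simp add: sqnorm_def)
  with \<open>p - p' \<in> K\<close> show ?thesis
    using subsetD[OF assms(2)] by (simp add: sqnorm_eq_0_iff)
qed

end

section \<open>Existence of the decomposition\<close>

locale complete_skew_symmetric_operator = skew_symmetric_operator V A0
  for V :: "('k::real_or_complex, 'v::ab_group_add) inner_space" and A0 +
  assumes complete: mcomplete
begin

text \<open>If \<open>(v, z)\<close> in the graph of \<open>A\<close> is orthogonal to the graph of \<open>A0\<close> in \<open>V \<times> V\<close>, then
  \<open>(z, v)\<close> is also in the graph of \<open>A\<close>, so \<open>v + z\<close> and \<open>v - z\<close> are eigenvectors of \<open>A\<close>.\<close>

lemma ex_decomposition:
  assumes w: "w \<in> op_dom A"
  shows "\<exists>w0 p m. is_decomposition V A0 w w0 p m"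
proof -
  have "\<exists>q\<in>graph_closure. \<forall>s\<in>op_graph A0. ip (prod_space V V) ((w, op_app A w) - q) s = 0"
    unfolding graph_closure_eq
  proof (rule VV.P.ex_orthogonal_projection)
    show "VV.P.mcomplete" by (rule VV.mcomplete_prod_space) (rule complete)+
    show "VV.P.subspace (op_graph A0)"
    proof (rule VV.P.subspaceI)
      have "op_app A0 0 = 0"
        using app_A0_scl[of 0 0] subspace_0[OF subspace_dom_A0] by simp
      then show "0 \<in> op_graph A0"
        using subspace_0[OF subspace_dom_A0] by (force simp: op_graph_def zero_prod_def)
    qed (auto simp: op_graph_def app_A0_add app_A0_scl image_iff
        intro: subspace_add[OF subspace_dom_A0] subspace_scale[OF subspace_dom_A0])
  qed (use w in \<open>auto simp: op_graph_def\<close>)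
  then obtain x y where xy: "(x, y) \<in> graph_closure"
    and orth: "\<And>u. u \<in> op_dom A0 \<Longrightarrow> ip V (w - x) u + ip V (op_app A w - y) (op_app A0 u) = 0"
    by (force simp: op_graph_def)
  define v where "v = w - x"
  define z where "z = op_app A w - y"
  have v: "v \<in> op_dom A" "op_app A v = z"
    using graph_closure_A[OF xy] A_diff[OF w] by (auto simp: v_def z_def)
  have z: "z \<in> op_dom A \<and> op_app A z = v"
    unfolding A_iff
  proof (intro conjI ballI)
    show c: "z \<in> carr V" "v \<in> carr V" using v A_carr by auto
    fix u assume u: "u \<in> op_dom A0"
    \<comment> \<open>Conjugating \<open>orth\<close> turns it into the condition of
      \<open>A_iff\<close> for the swapped pair \<open>(z, v)\<close>.\<close>
    have "conjg (ip V v u + ip V z (op_app A0 u)) = 0"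
      using orth[OF u] by (simp add: v_def z_def)
    then show "ip V (op_app A0 u) z + ip V u v = 0"
      using c u by (simp add: conjg_add add.commute flip: ip_commute)
  qed
  \<comment> \<open>\<open>A\<close> exchanges v and z, so it fixes p and negates m; the factor 1/2
    makes them add up to v.\<close>
  define p where "p = scl V (1/2) (v + z)"
  define m where "m = scl V (1/2) (v - z)"
  have "p \<in> Kp"
    using v z A_add[of v z] A_scl[of "v + z"] by (simp add: p_def Kp_iff add.commute)
  moreover have "m \<in> Km"
    using v z A_diff[of v z] A_scl[of "v - z"] by (simp add: m_def Km_iff flip: scale_minus_right)
  moreover have "p + m = v"
  proof -
    have "p + m = scl V (1/2) (v + v)"
      unfolding p_def m_def by (simp flip: scale_right_distrib)
    also have "v + v = scl V 2 v" using scale_left_distrib[of 1 1 v] by simp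
    finally show ?thesis by simp
  qed
  then have "w = x + p + m" by (simp add: v_def add.assoc)
  moreover have "x \<in> op_dom (op_closure V A0)" using xy by (auto simp: dom_op_closure)
  ultimately show ?thesis unfolding is_decomposition_def A_def[symmetric] by blast
qed

section \<open>The boundary maps\<close>

text \<open>In every decomposition of w the component in \<open>Kp\<close> satisfies the same test
  identity, hence equals p. With existence this evaluates the \<open>THE\<close>, and
  \<open>G_plus\<close> can be computed without exhibiting the other components.\<close>

lemma G_plus_eqI:
  assumes "w \<in> op_dom A" "p \<in> Kp" "\<And>q. q \<in> Kp \<Longrightarrow> boundary_form w q = 2 * ip V p q"
  shows "G_plus V A0 w = p"
proof -
  have eq: "p' = p" if d: "is_decomposition V A0 w w0 p' m" for w0 p' m
  proof (rule eq_if_ip_eq[OF subspace_Kp])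
    show "Kp \<subseteq> carr V" by (auto simp: Kp_iff)
    show "p' \<in> Kp" using decomposition_boundary_form[OF d] by blast
    fix q assume "q \<in> Kp"
    then have "2 * ip V p' q = 2 * ip V p q"
      using decomposition_boundary_form(4)[OF d, of q] assms(3)[of q] by simp
    then show "ip V p' q = ip V p q" by simp
  qed fact
  obtain w0 p' m where d: "is_decomposition V A0 w w0 p' m"
    using ex_decomposition[OF assms(1)] by blast
  with eq[OF d] show ?thesis
    unfolding G_plus_def by (intro the_equality) (auto dest: eq)
qed

lemma G_minus_eqI:
  assumes "w \<in> op_dom A" "m \<in> Km" "\<And>n. n \<in> Km \<Longrightarrow> boundary_form w n = - 2 * ip V m n"
  shows "G_minus V A0 w = m"
proof -
  have eq: "m' = m" if d: "is_decomposition V A0 w w0 p m'" for w0 m' p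
  proof (rule eq_if_ip_eq[OF subspace_Km])
    show "Km \<subseteq> carr V" by (auto simp: Km_iff)
    show "m' \<in> Km" using decomposition_boundary_form[OF d] by blast
    fix n assume "n \<in> Km"
    then have "- 2 * ip V m' n = - 2 * ip V m n"
      using decomposition_boundary_form(5)[OF d, of n] assms(3)[of n] by simp
    then show "ip V m' n = ip V m n" by simp
  qed fact
  obtain w0 m' p where d: "is_decomposition V A0 w w0 p m'"
    using ex_decomposition[OF assms(1)] by blast
  with eq[OF d] show ?thesis
    unfolding G_minus_def by (intro the_equality) (auto dest: eq)
qed

text \<open>The two maps come from separate descriptions; uniqueness of each component ties them to
  one common decomposition.\<close>

lemma decomposition_G:
  assumes "w \<in> op_dom A"
  shows "\<exists>w0. is_decomposition V A0 w w0 (G_plus V A0 w) (G_minus V A0 w)"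
proof -
  obtain w0 p m where d: "is_decomposition V A0 w w0 p m" using ex_decomposition[OF assms] by blast
  note b = decomposition_boundary_form[OF d]
  have "G_plus V A0 w = p" by (rule G_plus_eqI[OF assms b(2,4)])
  moreover have "G_minus V A0 w = m" by (rule G_minus_eqI[OF assms b(3,5)])
  ultimately show ?thesis using d by blast
qed

lemma G_boundary_form:
  assumes "w \<in> op_dom A"
  shows "G_plus V A0 w \<in> Kp" "G_minus V A0 w \<in> Km"
    and "\<And>q. q \<in> Kp \<Longrightarrow> boundary_form w q = 2 * ip V (G_plus V A0 w) q"
    and "\<And>n. n \<in> Km \<Longrightarrow> boundary_form w n = - 2 * ip V (G_minus V A0 w) n"
    and "\<And>v. v \<in> op_dom A \<Longrightarrow>
      boundary_form w v = boundary_form (G_plus V A0 w) v + boundary_form (G_minus V A0 w) v"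
proof -
  obtain w0 where d: "is_decomposition V A0 w w0 (G_plus V A0 w) (G_minus V A0 w)"
    using decomposition_G[OF assms] ..
  note b = decomposition_boundary_form[OF d]
  show "G_plus V A0 w \<in> Kp" "G_minus V A0 w \<in> Km" by (rule b)+
  show "boundary_form w q = 2 * ip V (G_plus V A0 w) q" if "q \<in> Kp" for q
    by (rule b(4)[OF that])
  show "boundary_form w n = - 2 * ip V (G_minus V A0 w) n" if "n \<in> Km" for n
    by (rule b(5)[OF that])
  show "boundary_form w v = boundary_form (G_plus V A0 w) v + boundary_form (G_minus V A0 w) v"
    if "v \<in> op_dom A" for v
    by (rule b(6)[OF that])
qed

text \<open>Both sides of the test identity in \<open>G_plus_eqI\<close> are linear in their first
  arguments, so the expected combination passes the test.\<close>

lemma G_plus_linear: "linear_map_on (op_dom A) (scl V) (scl V) (G_plus V A0)"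
  unfolding linear_map_on_def
proof (intro conjI ballI allI)
  fix u v a assume u: "u \<in> op_dom A"
  have *: "q \<in> carr V" "q \<in> op_dom A" if "q \<in> Kp" for q using that by (auto simp: Kp_iff)
  note G = G_boundary_form(1,3)
  show "G_plus V A0 (scl V a u) = scl V a (G_plus V A0 u)"
    using u G[OF u] * subspace_scale[OF subspace_Kp]
    by (intro G_plus_eqI) (auto simp: A_scl boundary_form_scl_left ip_scl_left)
  assume v: "v \<in> op_dom A"
  show "G_plus V A0 (u + v) = G_plus V A0 u + G_plus V A0 v"
    using u v G[OF u] G[OF v] * subspace_add[OF subspace_Kp]
    by (intro G_plus_eqI) (auto simp: A_add boundary_form_add_left ip_add_left distrib_left)
qed

lemma G_minus_linear: "linear_map_on (op_dom A) (scl V) (scl V) (G_minus V A0)"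
  unfolding linear_map_on_def
proof (intro conjI ballI allI)
  fix u v a assume u: "u \<in> op_dom A"
  have *: "n \<in> carr V" "n \<in> op_dom A" if "n \<in> Km" for n using that by (auto simp: Km_iff)
  note G = G_boundary_form(2,4)
  show "G_minus V A0 (scl V a u) = scl V a (G_minus V A0 u)"
    using u G[OF u] * subspace_scale[OF subspace_Km]
    by (intro G_minus_eqI) (auto simp: A_scl boundary_form_scl_left ip_scl_left)
  assume v: "v \<in> op_dom A"
  show "G_minus V A0 (u + v) = G_minus V A0 u + G_minus V A0 v"
    using u v G[OF u] G[OF v] * subspace_add[OF subspace_Km]
    by (intro G_minus_eqI) (auto simp: A_add boundary_form_add_left ip_add_left distrib_left)
qed

lemma G_plus_Kp: "p \<in> Kp \<Longrightarrow> G_plus V A0 p = p"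
  by (rule G_plus_eqI) (auto simp: boundary_form_Kp_Kp, simp add: Kp_iff)

lemma G_minus_Km: "m \<in> Km \<Longrightarrow> G_minus V A0 m = m"
  by (rule G_minus_eqI) (auto simp: boundary_form_Km_Km, simp add: Km_iff)

lemma G_plus_Km: "m \<in> Km \<Longrightarrow> G_plus V A0 m = 0"
  using subspace_0[OF subspace_Kp]
  by (intro G_plus_eqI) (auto simp: boundary_form_Km_Kp Kp_iff Km_iff)

section \<open>The boundary quadruple\<close>

lemma graph_ip_Kp: "\<lbrakk>u \<in> Kp; v \<in> Kp\<rbrakk> \<Longrightarrow> graph_ip V A u v = 2 * ip V u v"
  and graph_ip_Km: "\<lbrakk>u \<in> Km; v \<in> Km\<rbrakk> \<Longrightarrow> graph_ip V A u v = 2 * ip V u v"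
  by (auto simp: graph_ip_def Kp_iff Km_iff)

lemma H_plus_simps: "carr (H_plus V A0) = Kp" "scl (H_plus V A0) = scl V" "ip (H_plus V A0) = graph_ip V A"
  and H_minus_simps: "carr (H_minus V A0) = Km" "scl (H_minus V A0) = scl V" "ip (H_minus V A0) = graph_ip V A"
  by (simp_all add: H_plus_def H_minus_def A_def)

text \<open>The first argument is split into its two kernel components; each is then paired with v
  through the test identities for v, read in reverse order by Hermitian symmetry.\<close>

lemma boundary_form_G:
  assumes u: "u \<in> op_dom A" and v: "v \<in> op_dom A"
  shows "boundary_form u v = graph_ip V A (G_plus V A0 u) (G_plus V A0 v)
    - graph_ip V A (G_minus V A0 u) (G_minus V A0 v)"
proof -
  note Gu = G_boundary_form[OF u] and Gv = G_boundary_form[OF v]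
  have dom: "G_plus V A0 u \<in> op_dom A" "G_minus V A0 u \<in> op_dom A"
    "G_plus V A0 v \<in> op_dom A" "G_minus V A0 v \<in> op_dom A"
    using Gu Gv by (auto simp: Kp_iff Km_iff)
  have "boundary_form (G_plus V A0 u) v = 2 * ip V (G_plus V A0 u) (G_plus V A0 v)"
    using Gv(3)[OF Gu(1)] boundary_form_commute[OF v dom(1)] ip_commute[of "G_plus V A0 v" "G_plus V A0 u"] dom
    by (simp add: conjg_mult)
  moreover have "boundary_form (G_minus V A0 u) v = - 2 * ip V (G_minus V A0 u) (G_minus V A0 v)"
    using Gv(4)[OF Gu(2)] boundary_form_commute[OF v dom(2)] ip_commute[of "G_minus V A0 v" "G_minus V A0 u"] dom
    by (simp add: conjg_mult conjg_minus)
  ultimately show ?thesis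
    \<comment> \<open>The graph inner products absorb the factors 2, and the sign from
      \<open>Km\<close> produces the difference.\<close>
    using Gu(5)[OF v] Gu Gv by (simp add: graph_ip_Kp graph_ip_Km)
qed

lemma ker_G_sum: "{u + v | u v. u \<in> op_dom A \<and> G_minus V A0 u = 0 \<and> v \<in> op_dom A \<and> G_plus V A0 v = 0} = op_dom A"
proof (intro equalityI subsetI)
  fix w assume w: "w \<in> op_dom A"
  \<comment> \<open>With this m, the summand \<open>w - m\<close> is annihilated by
    \<open>G_minus\<close>, while m lies in \<open>Km\<close> and is annihilated by
    \<open>G_plus\<close>.\<close>
  define m where "m = G_minus V A0 w"
  have m: "m \<in> Km" "m \<in> op_dom A" using G_boundary_form[OF w] by (auto simp: m_def Km_iff)
  have wm: "w - m \<in> op_dom A" using A_diff w m by blast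
  have "G_minus V A0 (w - m + m) = G_minus V A0 (w - m) + G_minus V A0 m"
    using G_minus_linear wm m(2) unfolding linear_map_on_def by blast
  then have "G_minus V A0 (w - m) = 0" using G_minus_Km[OF m(1)] by (simp add: m_def[symmetric])
  moreover have "w = (w - m) + m" by simp
  ultimately show "w \<in> {u + v | u v. u \<in> op_dom A \<and> G_minus V A0 u = 0 \<and> v \<in> op_dom A \<and> G_plus V A0 v = 0}"
    using m wm G_plus_Km by blast
qed (auto simp: A_add)

lemma boundary_quadruple: "boundary_quadruple V A0 (H_minus V A0) (H_plus V A0) (G_minus V A0) (G_plus V A0)"
proof -
  have "pre_hilbert_space (H_plus V A0)"
    unfolding H_plus_def A_def[symmetric]
    using subspace_Kp by (rule pre_hilbert_space_scaled[where c = 2]) (auto simp: graph_ip_Kp, simp add: Kp_iff)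
  moreover have "pre_hilbert_space (H_minus V A0)"
    unfolding H_minus_def A_def[symmetric]
    using subspace_Km by (rule pre_hilbert_space_scaled[where c = 2]) (auto simp: graph_ip_Km, simp add: Km_iff)
  \<comment> \<open>Surjectivity holds because each boundary map fixes its target kernel
    pointwise.\<close>
  moreover have "G_plus V A0 ` op_dom A = Kp"
    using G_boundary_form(1) G_plus_Kp by (force simp: Kp_iff image_iff)
  moreover have "G_minus V A0 ` op_dom A = Km"
    using G_boundary_form(2) G_minus_Km by (force simp: Km_iff image_iff)
  ultimately show ?thesis
    unfolding boundary_quadruple_def A_def[symmetric] Let_def H_plus_simps H_minus_simps
    using G_plus_linear G_minus_linear boundary_form_G ker_G_sum
    by (auto simp: boundary_form_def)
qed

end

theorem proposition3p8:
  fixes V :: "('k::real_or_complex, 'v::ab_group_add) inner_space"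
    and A0 :: "'v oper"
  assumes "hilbert_space V"
    and "operator_on V A0"
    and "densely_defined V A0"
    and "skew_symmetric V A0"
  shows "boundary_quadruple V A0 (H_minus V A0) (H_plus V A0) (G_minus V A0) (G_plus V A0)
    \<and> (\<forall>u\<in>carr (H_minus V A0). \<forall>v\<in>carr (H_minus V A0). ip (H_minus V A0) u v = 2 * ip V u v)
    \<and> (\<forall>u\<in>carr (H_plus V A0). \<forall>v\<in>carr (H_plus V A0). ip (H_plus V A0) u v = 2 * ip V u v)"
proof -
  interpret pre_hilbert V
    using assms(1) by unfold_locales (simp add: hilbert_space_def)
  interpret complete_skew_symmetric_operator V A0
    using assms by unfold_locales (simp_all add: hilbert_space_def)
  show ?thesis
    using boundary_quadruple graph_ip_Kp graph_ip_Km by (simp add: H_plus_simps H_minus_simps)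
qed

end
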